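(* Let $P=(G,R)$ be a partial field, $n\in\mathbb{N}$, $N=2^n-1$, and let $p=(p_J)_{J\subseteq[n]}\in\mathbf{P}^N(P)$ with representative chosen so that $p_\emptyset=1$. The following are equivalent: \begin{enumerate} \item There exists a skew-symmetric $n\times n$ matrix $A$ with entries in $P$ such that $p_J=\mathrm{Pf}(A_J)$ for all $J\subseteq[n]$. \item $p$ is a strong orthogonal matroid over $P$. \item $p$ is a weak orthogonal matroid over $P$. \end{enumerate}
   Context: A partial field $P=(G,R)$ consists of a commutative ring $R$ with $1$ and a subgroup $G$ of its unit group containing $-1$; elements of $P$ are those of $G\cup\{0\}$; $\mathbf{P}^N(P)$ is the set of nonzero vectors $(p_J)_{J\subseteq[n]}$ with entries in $G\cup\{0\}$ modulo scaling by $G$; all equations are interpreted in $R$. $\Delta$ denotes symmetric difference. For $J\subseteq[n]$, $A_J$ is the principal submatrix with rows and columns $J$ (increasing order). Pfaffian: empty matrix has $\mathrm{Pf}=1$; odd size gives $0$; $\mathrm{Pf}\begin{pmatrix}0&a\\-a&0\end{pmatrix}=a$; for even size $m\ge 4$, $\mathrm{Pf}(A)=\sum_{j=2}^m(-1)^j\mathrm{Pf}(A_{\{1,j\}})\mathrm{Pf}(A_{\{2,\dots,m\}\setminus\{j\}})$. Wick equations: $\sum_{j=1}^{k}(-1)^jX_{J_1\Delta\{i_j\}}X_{J_2\Delta\{i_j\}}=0$ for all $J_1,J_2\subseteq[n]$ with $J_1\Delta J_2=\{i_1<\dots<i_k\}$; the $4$-term Wick equations are those with $k=4$. A strong orthogonal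 matroid over $P$ is a point of $\mathbf{P}^N(P)$ satisfying all Wick equations; a weak orthogonal matroid over $P$ is a point of $\mathbf{P}^N(P)$ satisfying the $4$-term Wick equations whose support $\{J: p_J\ne0\}$ is the set of bases of an orthogonal matroid. An orthogonal matroid on $E$ is a nonempty collection $\mathcal{B}$ of subsets of $E$ such that for all $B_1,B_2\in\mathcal{B}$ and $x_1\in B_1\Delta B_2$ there is $x_2\in B_1\Delta B_2$, $x_2\neq x_1$, with $B_1\Delta\{x_1,x_2\}\in\mathcal{B}$. *)

theory Defs
  imports
    "HOL-Library.FuncSet"
    "Jordan_Normal_Form.Matrix"
    "Jordan_Normal_Form.DL_Submatrix"
begin

text \<open>
  Indices are shifted by one, as is customary for \<^typ>\<open>'a mat\<close>: the ground set
  $[n]$ is \<^term>\<open>{..<n}\<close>, with its natural order.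
\<close>

text \<open>
  A partial field $(G, R)$: the ring $R$ is the type, and \<open>G\<close> is a subgroup of its unit group
  containing $-1$. The class excludes the zero ring, over which there are no nonzero vectors.
\<close>

definition partial_field :: "'a::comm_ring_1 set \<Rightarrow> bool" where
  "partial_field G \<longleftrightarrow>
     1 \<in> G \<and> -1 \<in> G \<and> (\<forall>x\<in>G. \<forall>y\<in>G. x * y \<in> G) \<and> (\<forall>x\<in>G. \<exists>y\<in>G. x * y = 1)"

definition nonzero_vectors :: "'a::comm_ring_1 set \<Rightarrow> nat \<Rightarrow> (nat set \<Rightarrow> 'a) set" where
  "nonzero_vectors G n =
     {p \<in> Pow {..<n} \<rightarrow>\<^sub>E insert 0 G. \<exists>J\<subseteq>{..<n}. p J \<noteq> 0}"

definition scaling_rel ::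
    "'a::comm_ring_1 set \<Rightarrow> nat \<Rightarrow> ((nat set \<Rightarrow> 'a) \<times> (nat set \<Rightarrow> 'a)) set" where
  "scaling_rel G n =
     {(p, q). p \<in> nonzero_vectors G n \<and> q \<in> nonzero_vectors G n \<and>
              (\<exists>g\<in>G. \<forall>J\<subseteq>{..<n}. q J = g * p J)}"

text \<open>The space $\mathbf{P}^N(P)$ with $N = 2^n - 1$; its points are classes of vectors.\<close>

definition projective_space :: "'a::comm_ring_1 set \<Rightarrow> nat \<Rightarrow> (nat set \<Rightarrow> 'a) set set" where
  "projective_space G n = nonzero_vectors G n // scaling_rel G n"

text \<open>
  The Pfaffian is only meaningful on alternating matrices, so skew-symmetry includes a zero
  diagonal; this is not automatic when $2$ is a zero divisor in the ring.
\<close>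

definition skew_symmetric :: "'a::comm_ring_1 mat \<Rightarrow> bool" where
  "skew_symmetric A \<longleftrightarrow> square_mat A \<and> transpose_mat A = - A \<and> (\<forall>i<dim_row A. A $$ (i, i) = 0)"

text \<open>
  Expansion along the first row. Because of the index shift, the term for row and column
  $j + 1$ carries the sign $(-1)^{j+1}$.
\<close>

function pfaffian :: "'a::comm_ring_1 mat \<Rightarrow> 'a" where
  "pfaffian A =
     (let m = dim_row A in
      if m = 0 then 1
      else if odd m then 0
      else if m = 2 then A $$ (0, 1)
      else (\<Sum>j\<in>{1..<m}. (-1) ^ (j + 1) * pfaffian (submatrix A {0, j} {0, j})
              * pfaffian (submatrix A ({1..<m} - {j}) ({1..<m} - {j}))))"
  by pat_completeness auto

termination
proof (relation "measure dim_row", goal_cases)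
  case 1
  show ?case by simp
next
  case (2 A m j)
  have "{i. i < dim_row A \<and> i \<in> {0, j}} \<subseteq> {0, j}" by auto
  then have "card {i. i < dim_row A \<and> i \<in> {0, j}} \<le> card {0, j}"
    by (intro card_mono) auto
  also have "\<dots> \<le> 2" by (simp add: card_insert_if)
  also have "2 < dim_row A" using 2 by (cases "dim_row A = 1") auto
  finally show ?case by (simp add: dim_submatrix)
next
  case (3 A m j)
  have "card {i. i < dim_row A \<and> i \<in> {1..<m} - {j}} \<le> card {1..<m}"
    by (intro card_mono) auto
  also have "\<dots> < dim_row A" using 3 by simp
  finally show ?case by (simp add: dim_submatrix)
qed

declare pfaffian.simps [simp del]

definition wick_equation :: "(nat set \<Rightarrow> 'a::comm_ring_1) \<Rightarrow> nat set \<Rightarrow> nat set \<Rightarrow> bool" where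
  "wick_equation X J1 J2 \<longleftrightarrow>
     (let is = sorted_list_of_set (sym_diff J1 J2) in
      (\<Sum>j = 1..length is. (-1) ^ j * X (sym_diff J1 {is ! (j - 1)})
                                  * X (sym_diff J2 {is ! (j - 1)})) = 0)"

definition orthogonal_matroid :: "'b set \<Rightarrow> 'b set set \<Rightarrow> bool" where
  "orthogonal_matroid E \<B> \<longleftrightarrow>
     \<B> \<subseteq> Pow E \<and> \<B> \<noteq> {} \<and>
     (\<forall>B1\<in>\<B>. \<forall>B2\<in>\<B>. \<forall>x1\<in>sym_diff B1 B2.
        \<exists>x2\<in>sym_diff B1 B2. x2 \<noteq> x1 \<and> sym_diff B1 {x1, x2} \<in> \<B>)"

definition vector_support :: "nat \<Rightarrow> (nat set \<Rightarrow> 'a::comm_ring_1) \<Rightarrow> nat set set" where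
  "vector_support n p = {J. J \<subseteq> {..<n} \<and> p J \<noteq> 0}"

text \<open>
  The conditions on a point are imposed on all of its representatives. They do not depend on
  the representative, see \<open>wick_equation_cong\<close> and \<open>vector_support_cong\<close> below.
\<close>

definition strong_orthogonal_matroid ::
    "'a::comm_ring_1 set \<Rightarrow> nat \<Rightarrow> (nat set \<Rightarrow> 'a) set \<Rightarrow> bool" where
  "strong_orthogonal_matroid G n c \<longleftrightarrow>
     c \<in> projective_space G n \<and>
     (\<forall>p\<in>c. \<forall>J1 J2. J1 \<subseteq> {..<n} \<longrightarrow> J2 \<subseteq> {..<n} \<longrightarrow> wick_equation p J1 J2)"

definition weak_orthogonal_matroid ::
    "'a::comm_ring_1 set \<Rightarrow> nat \<Rightarrow> (nat set \<Rightarrow> 'a) set \<Rightarrow> bool" where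
  "weak_orthogonal_matroid G n c \<longleftrightarrow>
     c \<in> projective_space G n \<and>
     (\<forall>p\<in>c. (\<forall>J1 J2. J1 \<subseteq> {..<n} \<longrightarrow> J2 \<subseteq> {..<n} \<longrightarrow> card (sym_diff J1 J2) = 4
                  \<longrightarrow> wick_equation p J1 J2) \<and>
            orthogonal_matroid {..<n} (vector_support n p))"

lemma partial_field_mult_eq_0:
  assumes "partial_field G" "g \<in> G"
  shows "g * x = 0 \<longleftrightarrow> x = 0"
proof
  assume "g * x = 0"
  obtain h where "g * h = 1" using assms by (auto simp: partial_field_def)
  then have "x = h * (g * x)" by (metis mult.assoc mult.commute mult_1)
  with \<open>g * x = 0\<close> show "x = 0" by simp
qed simp

lemma equiv_scaling_rel:
  assumes "partial_field G"
  shows "equiv (nonzero_vectors G n) (scaling_rel G n)"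
proof (rule equivI)
  show "scaling_rel G n \<subseteq> nonzero_vectors G n \<times> nonzero_vectors G n"
    by (auto simp: scaling_rel_def)
  show "refl_on (nonzero_vectors G n) (scaling_rel G n)"
    using assms by (auto simp: refl_on_def scaling_rel_def partial_field_def intro!: bexI[of _ 1])
  show "sym (scaling_rel G n)"
  proof (rule symI)
    fix p q assume pq: "(p, q) \<in> scaling_rel G n"
    then obtain g where g: "g \<in> G" "\<forall>J\<subseteq>{..<n}. q J = g * p J"
      by (auto simp: scaling_rel_def)
    obtain h where h: "h \<in> G" "g * h = 1" using assms g by (auto simp: partial_field_def)
    have "\<forall>J\<subseteq>{..<n}. p J = h * q J"
      using g h by (metis mult.assoc mult.commute mult_1)
    with pq h show "(q, p) \<in> scaling_rel G n" by (auto simp: scaling_rel_def)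
  qed
  show "trans (scaling_rel G n)"
  proof (rule transI)
    fix p q r assume pq: "(p, q) \<in> scaling_rel G n" and qr: "(q, r) \<in> scaling_rel G n"
    then obtain g h where "g \<in> G" "\<forall>J\<subseteq>{..<n}. q J = g * p J" "h \<in> G" "\<forall>J\<subseteq>{..<n}. r J = h * q J"
      by (auto simp: scaling_rel_def)
    then have "h * g \<in> G" "\<forall>J\<subseteq>{..<n}. r J = (h * g) * p J"
      using assms by (auto simp: partial_field_def mult.assoc)
    with pq qr show "(p, r) \<in> scaling_rel G n" unfolding scaling_rel_def by blast
  qed
qed

lemma vector_support_cong:
  assumes "partial_field G" "(p, q) \<in> scaling_rel G n"
  shows "vector_support n q = vector_support n p"
  using assms by (auto simp: vector_support_def scaling_rel_def partial_field_mult_eq_0)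

lemma wick_equation_cong:
  assumes "partial_field G" "(p, q) \<in> scaling_rel G n" "J1 \<subseteq> {..<n}" "J2 \<subseteq> {..<n}"
  shows "wick_equation q J1 J2 \<longleftrightarrow> wick_equation p J1 J2"
proof -
  obtain g where g: "g \<in> G" "\<And>J. J \<subseteq> {..<n} \<Longrightarrow> q J = g * p J"
    using assms by (auto simp: scaling_rel_def)
  define xs where "xs = sorted_list_of_set (sym_diff J1 J2)"
  have fin: "finite (sym_diff J1 J2)"
    using assms by (meson finite_Diff finite_UnI finite_lessThan finite_subset)
  have xs: "xs ! (j - 1) < n" if "j \<in> {1..length xs}" for j
  proof -
    have "xs ! (j - 1) \<in> set xs" using that by (intro nth_mem) auto
    also have "set xs = sym_diff J1 J2" using fin by (simp add: xs_def)
    finally show ?thesis using assms by auto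
  qed
  have eq: "q (sym_diff J {xs ! (j - 1)}) = g * p (sym_diff J {xs ! (j - 1)})"
    if "j \<in> {1..length xs}" "J \<subseteq> {..<n}" for j J
    using xs[OF that(1)] that(2) by (intro g(2)) auto
  have "(\<Sum>j = 1..length xs. (-1) ^ j * q (sym_diff J1 {xs ! (j - 1)}) * q (sym_diff J2 {xs ! (j - 1)}))
      = (\<Sum>j = 1..length xs. (g * g) *
          ((-1) ^ j * p (sym_diff J1 {xs ! (j - 1)}) * p (sym_diff J2 {xs ! (j - 1)})))"
    by (intro sum.cong refl, subst (1 2) eq) (use assms in \<open>auto simp: mult_ac\<close>)
  also have "\<dots> = g * (g * (\<Sum>j = 1..length xs.
          (-1) ^ j * p (sym_diff J1 {xs ! (j - 1)}) * p (sym_diff J2 {xs ! (j - 1)})))"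
    by (simp only: sum_distrib_left mult.assoc)
  finally show ?thesis
    using partial_field_mult_eq_0[OF assms(1) g(1)]
    unfolding wick_equation_def Let_def xs_def[symmetric] by simp
qed

end

theory Submission
  imports Defs
begin

text \<open>
  Write $Q(x, K)$ for the Pfaffian of the word $x K$, expanded along its first letter:
  $Q(x, K) = \sum_{j \in K} \pm a_{xj} \mathrm{Pf}(K - j)$. Up to the sign of the position of $x$
  this is $\mathrm{Pf}(K \cup x)$, and it vanishes for $x \in K$. Hence the Wick sum for $I, J$ is
  $\sum_{i \in I} \pm \mathrm{Pf}(I - i) Q(i, J) + \sum_{j \in J} \pm \mathrm{Pf}(J - j) Q(j, I)$.
  Expanding both $Q$'s gives two double sums over $I \times J$ which cancel by skew-symmetry.

  In the other direction put $a_{ij} = p_{ij}$. The 4-term Wick equations and the exchange axiom with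
  the empty basis determine all coordinates $p_J$ from those with $|J| \le 2$, and the Pfaffians
  satisfy the same equations.
\<close>

subsection \<open>Signs of positions\<close>

text \<open>For \<open>x\<close> outside \<open>K\<close> this is the sign of the permutation that
  sorts the word \<open>x K\<close>. Since \<open>x\<close> itself is never counted,
  \<open>K\<close>, \<open>K - {x}\<close> and \<open>insert x K\<close> all give the same
  sign.\<close>

definition pos_sign :: "'b::linorder \<Rightarrow> 'b set \<Rightarrow> 'a::comm_ring_1" where
  "pos_sign x K = (-1) ^ card {k \<in> K. k < x}"

text \<open>The factor by which \<open>pos_sign x\<close> changes when \<open>k\<close> enters or
  leaves a set; it is its own inverse.\<close>

definition less_sign :: "'b::linorder \<Rightarrow> 'b \<Rightarrow> 'a::comm_ring_1" where
  "less_sign k x = (if k < x then -1 else 1)"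

lemma less_sign_swap: "k \<noteq> x \<Longrightarrow> less_sign x k = - less_sign k x"
  by (auto simp: less_sign_def)

lemma pos_sign_square [simp]: "pos_sign x K * pos_sign x K = 1"
  by (simp add: pos_sign_def flip: power_add mult_2)

lemma pos_sign_square_left [simp]: "pos_sign x K * (pos_sign x K * y) = y"
  by (simp flip: mult.assoc)

lemma pos_sign_insert:
  assumes "finite K" "k \<notin> K"
  shows "pos_sign x (insert k K) = less_sign k x * pos_sign x K"
proof -
  have "{j \<in> insert k K. j < x} = (if k < x then insert k {j \<in> K. j < x} else {j \<in> K. j < x})"
    by auto
  then show ?thesis using assms by (simp add: pos_sign_def less_sign_def)
qed

lemma pos_sign_remove:
  assumes "finite K" "k \<in> K"
  shows "pos_sign x (K - {k}) = less_sign k x * (pos_sign x K :: 'a::comm_ring_1)"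
proof -
  have "pos_sign x K = less_sign k x * (pos_sign x (K - {k}) :: 'a)"
    using pos_sign_insert[of "K - {k}" k x] assms by (simp add: insert_absorb)
  then show ?thesis by (auto simp: less_sign_def)
qed

lemma pos_sign_Min: "\<forall>k\<in>K. x \<le> k \<Longrightarrow> pos_sign x K = 1"
proof -
  assume "\<forall>k\<in>K. x \<le> k"
  then have "{k \<in> K. k < x} = {}" by auto
  then show ?thesis by (simp only: pos_sign_def card.empty power_0)
qed

text \<open>Elements of \<open>I \<inter> J\<close> are counted twice on the right, which leaves the
  parity unchanged. This splits the sign in a Wick sum into a position in \<open>I\<close> and a
  position in \<open>J\<close>.\<close>

lemma pos_sign_sym_diff:
  assumes "finite I" "finite J"
  shows "pos_sign x (sym_diff I J) = pos_sign x I * pos_sign x J"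
proof -
  define f where "f K = {k \<in> K. k < x}" for K
  have fin: "finite (f I)" "finite (f J)" using assms by (auto simp: f_def)
  have "card (f I) = card (f I - f J) + card (f I \<inter> f J)"
    by (metis Diff_Diff_Int Diff_subset card_Diff_subset card_mono fin(1) finite_Diff le_add_diff_inverse2 add.commute)
  moreover have "card (f J) = card (f J - f I) + card (f I \<inter> f J)"
    by (metis Diff_Diff_Int Diff_subset card_Diff_subset card_mono fin(2) finite_Diff le_add_diff_inverse2 add.commute inf_commute)
  moreover have "f (sym_diff I J) = (f I - f J) \<union> (f J - f I)" by (auto simp: f_def)
  then have "card (f (sym_diff I J)) = card (f I - f J) + card (f J - f I)"
    using fin by (subst card_Un_disjoint[symmetric]) auto
  ultimately have "card (f I) + card (f J) = card (f (sym_diff I J)) + 2 * card (f I \<inter> f J)"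
    by simp
  then show ?thesis unfolding pos_sign_def f_def[symmetric]
    by (simp add: power_add flip: power_add) (simp add: power_add power_mult)
qed

text \<open>The terms for \<open>(j, l)\<close> and \<open>(l, j)\<close> cancel. The induction
  removes them in pairs; interchanging the sums would only show that twice the sum is zero, and 2
  may be a zero divisor.\<close>

lemma sum_antisymmetric:
  fixes f :: "'b \<Rightarrow> 'b \<Rightarrow> 'a::comm_ring_1"
  assumes "finite L" "\<And>j l. j \<in> L \<Longrightarrow> l \<in> L \<Longrightarrow> j \<noteq> l \<Longrightarrow> f j l = - f l j"
  shows "(\<Sum>j\<in>L. \<Sum>l\<in>L - {j}. f j l) = 0"
  using assms
proof (induction L rule: finite_induct)
  case (insert x L)
  have "(\<Sum>l\<in>insert x L - {j}. f j l) = f j x + (\<Sum>l\<in>L - {j}. f j l)" if "j \<in> L" for j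
  proof -
    have "insert x L - {j} = insert x (L - {j})" using that insert.hyps by auto
    then show ?thesis using insert.hyps by simp
  qed
  moreover have "(\<Sum>l\<in>insert x L - {x}. f x l) = - (\<Sum>j\<in>L. f j x)"
  proof -
    have "insert x L - {x} = L" using insert.hyps by auto
    moreover have "f x l = - f l x" if "l \<in> L" for l
      by (rule insert.prems) (use that insert.hyps in auto)
    ultimately show ?thesis by (simp flip: sum_negf)
  qed
  moreover have "(\<Sum>j\<in>L. \<Sum>l\<in>L - {j}. f j l) = 0"
    by (rule insert.IH) (rule insert.prems, auto)
  ultimately show ?case using insert.hyps by (simp add: sum.distrib)
qed simp

lemma sum_swap_distinct:
  assumes "finite L"
  shows "(\<Sum>j\<in>L. \<Sum>l\<in>L - {j}. f j l) = (\<Sum>l\<in>L. \<Sum>j\<in>L - {l}. f j l)"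
proof -
  have "L - {j} = {l \<in> L. l \<noteq> j}" "L - {j} = {l \<in> L. j \<noteq> l}" for j by auto
  then show ?thesis using sum.swap_restrict[OF assms assms, of f "\<lambda>j l. l \<noteq> j"] by simp
qed

subsection \<open>Functions with a Pfaffian expansion\<close>

text \<open>Set functions replace matrices here, so that no reindexing enters the sign computations.
  Only the expansion along the least element is assumed. For \<open>i = j\<close>,
  \<open>skew\<close> says only \<open>2 * a i i = 0\<close>, so a zero diagonal is assumed
  separately where it is used.\<close>

locale pfaffian_function =
  fixes V :: "'b::linorder set" and a :: "'b \<Rightarrow> 'b \<Rightarrow> 'a::comm_ring_1" and P :: "'b set \<Rightarrow> 'a"
  assumes finite_V: "finite V"
    and skew: "i \<in> V \<Longrightarrow> j \<in> V \<Longrightarrow> a j i = - a i j"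
    and expand_Min: "insert m K \<subseteq> V \<Longrightarrow> \<forall>k\<in>K. m < k \<Longrightarrow>
          P (insert m K) = (\<Sum>j\<in>K. pos_sign j K * a m j * P (K - {j}))"
begin

text \<open>The Pfaffian of the word consisting of \<open>x\<close> followed by the elements of \<open>K\<close> in order.\<close>

definition row_sum :: "'b \<Rightarrow> 'b set \<Rightarrow> 'a" where
  "row_sum x K = (\<Sum>j\<in>K. pos_sign j K * a x j * P (K - {j}))"

text \<open>By induction on \<open>K\<close>. If \<open>x\<close> is not the least letter, both
  sides are expanded along \<open>m = Min K\<close>: the left one inside its cofactors, the right
  one directly and then by the induction hypothesis. The same double sum results.\<close>

lemma row_sum_notin:
  assumes "insert x K \<subseteq> V" "x \<notin> K"
  shows "row_sum x K = pos_sign x K * P (insert x K)"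
proof -
  have "finite K" using assms finite_V finite_subset by auto
  then show ?thesis using assms
  proof (induction K rule: finite_psubset_induct)
    case (psubset K)
    show ?case
    proof (cases "\<forall>k\<in>K. x < k")
      case True
      then show ?thesis using expand_Min[OF psubset.prems(1) True]
        by (simp add: row_sum_def pos_sign_Min less_imp_le)
    next
      case False
      then have "K \<noteq> {}" by auto
      define m L where "m = Min K" and "L = K - {m}"
      have m: "m \<in> K" "\<forall>k\<in>L. m < k"
        using \<open>K \<noteq> {}\<close> psubset.hyps by (auto simp: m_def L_def less_le)
      have K: "K = insert m L" "m \<notin> L" using m by (auto simp: L_def)
      \<comment> \<open>Thus \<open>m\<close> is the least element of \<open>insert x K\<close> as
        well, and \<open>expand_Min\<close> applies to it.\<close>
      have mx: "m < x" 
      proof -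
        obtain k where "k \<in> K" "\<not> x < k" using False by auto
        moreover from this have "m \<le> k" using psubset.hyps by (simp add: m_def)
        moreover have "m \<noteq> x" using psubset.prems m by auto
        ultimately show ?thesis by simp
      qed
      have L: "finite L" "x \<notin> L" "m \<in> V" "x \<in> V" "L \<subseteq> V"
        using psubset K by auto
      \<comment> \<open>The summand in which \<open>x\<close> is matched with \<open>j\<close> and
        \<open>m\<close> with \<open>l\<close>; both sides become sums of these.\<close>
      define F where "F j l = pos_sign j L * a x j * (pos_sign l (L - {j}) * a m l * P (L - {j} - {l}))" for j l
      have "row_sum x K = a x m * P L + (\<Sum>j\<in>L. pos_sign j K * a x j * P (K - {j}))"
        unfolding row_sum_def K(1) using L K m by (simp add: pos_sign_Min less_imp_le)
      also have "(\<Sum>j\<in>L. pos_sign j K * a x j * P (K - {j})) = (\<Sum>j\<in>L. \<Sum>l\<in>L - {j}. - F j l)"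
      proof (rule sum.cong[OF refl])
        fix j assume j: "j \<in> L"
        have "K - {j} = insert m (L - {j})" using j K by auto
        moreover have "P (insert m (L - {j})) = (\<Sum>l\<in>L - {j}. pos_sign l (L - {j}) * a m l * P (L - {j} - {l}))"
          by (rule expand_Min) (use L m in auto)
        moreover have "pos_sign j K = - (pos_sign j L :: 'a)"
          using j m L K by (simp add: pos_sign_insert less_sign_def)
        ultimately show "pos_sign j K * a x j * P (K - {j}) = (\<Sum>l\<in>L - {j}. - F j l)"
          by (simp add: F_def sum_distrib_left sum_negf)
      qed
      also have "\<dots> = (\<Sum>l\<in>L. \<Sum>j\<in>L - {l}. - F j l)" by (rule sum_swap_distinct[OF L(1)])
      finally have 1: "row_sum x K = a x m * P L + (\<Sum>l\<in>L. \<Sum>j\<in>L - {l}. - F j l)" .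
      have "P (insert x K) = P (insert m (insert x L))" using K by (simp add: insert_commute)
      also have "\<dots> = (\<Sum>l\<in>insert x L. pos_sign l (insert x L) * a m l * P (insert x L - {l}))"
        by (rule expand_Min) (use L m mx in auto)
      also have "\<dots> = pos_sign x L * a m x * P L
          + (\<Sum>l\<in>L. pos_sign l (insert x L) * a m l * P (insert x L - {l}))"
        using L by (simp add: pos_sign_insert less_sign_def)
      also have "(\<Sum>l\<in>L. pos_sign l (insert x L) * a m l * P (insert x L - {l}))
          = (\<Sum>l\<in>L. \<Sum>j\<in>L - {l}. pos_sign x L * F j l)"
      proof (rule sum.cong[OF refl])
        fix l assume l: "l \<in> L"
        then have xl: "x \<noteq> l" using L by auto
        have "row_sum x (L - {l}) = pos_sign x (L - {l}) * P (insert x (L - {l}))"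
          by (rule psubset.IH) (use l L K in auto)
        moreover have "insert x L - {l} = insert x (L - {l})" using xl by auto
        ultimately have "P (insert x L - {l}) = pos_sign x (L - {l}) * row_sum x (L - {l})" by simp
        then have "pos_sign l (insert x L) * a m l * P (insert x L - {l}) =
            (\<Sum>j\<in>L - {l}. pos_sign l (insert x L) * a m l * (pos_sign x (L - {l}) *
               (pos_sign j (L - {l}) * a x j * P (L - {l} - {j}))))"
          by (simp add: row_sum_def sum_distrib_left)
        also have "\<dots> = (\<Sum>j\<in>L - {l}. pos_sign x L * F j l)"
        proof (rule sum.cong[OF refl])
          fix j assume j: "j \<in> L - {l}"
          have "pos_sign l (insert x L) * pos_sign x (L - {l}) * pos_sign j (L - {l})
             = less_sign x l * less_sign l x * less_sign l j * pos_sign l L * pos_sign x L * (pos_sign j L :: 'a)"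
            using l j L by (simp add: pos_sign_insert pos_sign_remove)
          \<comment> \<open>As \<open>x\<close> and \<open>l\<close> differ,
            \<open>less_sign x l * less_sign l x = -1\<close>; the remaining
            \<open>- less_sign l j\<close> equals \<open>less_sign j l\<close>, the factor for
            removing \<open>j\<close> from \<open>L\<close>.\<close>
          also have "\<dots> = pos_sign x L * pos_sign j L * pos_sign l (L - {j})"
            using l j L xl by (auto simp: pos_sign_remove less_sign_def not_less order.antisym)
          finally have *: "pos_sign l (insert x L) * pos_sign x (L - {l}) * pos_sign j (L - {l}) =
              pos_sign x L * pos_sign j L * (pos_sign l (L - {j}) :: 'a)" .
          have "L - {l} - {j} = L - {j} - {l}" by auto
          then have "pos_sign l (insert x L) * a m l * (pos_sign x (L - {l}) * (pos_sign j (L - {l}) * a x j * P (L - {l} - {j})))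
            = (pos_sign l (insert x L) * pos_sign x (L - {l}) * pos_sign j (L - {l})) * (a m l * a x j * P (L - {j} - {l}))"
            by (simp add: mult_ac)
          then show "pos_sign l (insert x L) * a m l * (pos_sign x (L - {l}) * (pos_sign j (L - {l}) * a x j * P (L - {l} - {j})))
            = pos_sign x L * F j l"
            unfolding * by (simp add: F_def mult_ac)
        qed
        finally show "pos_sign l (insert x L) * a m l * P (insert x L - {l}) = (\<Sum>j\<in>L - {l}. pos_sign x L * F j l)" .
      qed
      finally have 2: "P (insert x K) = pos_sign x L * (a m x * P L + (\<Sum>l\<in>L. \<Sum>j\<in>L - {l}. F j l))"
        by (simp add: sum_distrib_left distrib_left mult.assoc)
      \<comment> \<open>This sign makes up for \<open>a x m = - a m x\<close> and for the minus sign
        of the double sum in \<open>1\<close>.\<close>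
      have "pos_sign x K = - (pos_sign x L :: 'a)"
        using K L mx by (simp add: pos_sign_insert less_sign_def)
      then show ?thesis using 1 2 skew[of m x] L by (simp add: sum_negf)
    qed
  qed
qed

text \<open>Expanding each cofactor along \<open>x\<close> once more gives an antisymmetric double sum.\<close>

lemma row_sum_in:
  assumes "K \<subseteq> V" "x \<in> K" "a x x = 0"
  shows "row_sum x K = 0"
proof -
  define L where "L = K - {x}"
  have L: "finite L" "x \<notin> L" "K = insert x L" "insert x L \<subseteq> V"
    using assms finite_V finite_subset by (auto simp: L_def)
  \<comment> \<open>Everything after \<open>less_sign j l\<close> is symmetric in \<open>j\<close>
    and \<open>l\<close>, so \<open>F\<close> is antisymmetric.\<close>
  define F where "F j l = less_sign j l * (pos_sign x L * pos_sign j L * pos_sign l L *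
      a x j * a x l * P (L - {j} - {l}))" for j l
  \<comment> \<open>The term for \<open>x\<close> itself drops out because of
    \<open>a x x = 0\<close>.\<close>
  have "row_sum x K = (\<Sum>j\<in>L. pos_sign j K * a x j * P (K - {j}))"
    using L assms by (simp add: row_sum_def)
  also have "\<dots> = (\<Sum>j\<in>L. \<Sum>l\<in>L - {j}. - F j l)"
  proof (rule sum.cong[OF refl])
    fix j assume j: "j \<in> L"
    then have xj: "x \<noteq> j" using L by auto
    have "row_sum x (L - {j}) = pos_sign x (L - {j}) * P (insert x (L - {j}))"
      by (rule row_sum_notin) (use L in auto)
    moreover have "K - {j} = insert x (L - {j})" using xj L by auto
    ultimately have "P (K - {j}) = pos_sign x (L - {j}) * row_sum x (L - {j})" by simp
    moreover have "pos_sign j K * pos_sign x (L - {j}) = - (pos_sign j L * pos_sign x L :: 'a)"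
      using j L xj
      by (auto simp: pos_sign_insert pos_sign_remove less_sign_def)
    ultimately have "pos_sign j K * a x j * P (K - {j}) = - (pos_sign j L * pos_sign x L) * a x j * row_sum x (L - {j})"
      by (metis mult.assoc mult.commute)
    also have "\<dots> = (\<Sum>l\<in>L - {j}. - F j l)"
      unfolding row_sum_def sum_distrib_left F_def
      using j L by (intro sum.cong refl) (simp add: pos_sign_remove mult_ac)
    finally show "pos_sign j K * a x j * P (K - {j}) = (\<Sum>l\<in>L - {j}. - F j l)" .
  qed
  also have "\<dots> = 0"
  proof (rule sum_antisymmetric[OF L(1)])
    fix j l :: 'b assume "j \<noteq> l"
    then have "less_sign j l = - (less_sign l j :: 'a)" by (intro less_sign_swap) auto
    moreover have "L - {j} - {l} = L - {l} - {j}" by auto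
    ultimately have "F j l = - F l j" by (simp add: F_def mult_ac)
    then show "- F j l = - (- F l j)" by simp
  qed
  finally show ?thesis .
qed

lemma wick_relation:
  assumes "I \<subseteq> V" "J \<subseteq> V" "\<And>i. i \<in> V \<Longrightarrow> a i i = 0"
  shows "(\<Sum>x\<in>sym_diff I J. pos_sign x (sym_diff I J) * P (sym_diff I {x}) * P (sym_diff J {x})) = 0"
proof -
  have fin: "finite I" "finite J" using assms finite_V by (auto intro: finite_subset)
  define T where "T x = pos_sign x (sym_diff I J) * P (sym_diff I {x}) * P (sym_diff J {x})" for x
  \<comment> \<open>Used for \<open>(I, J)\<close> and for \<open>(J, I)\<close>. Summing over all
    of \<open>I\<close> adds only zero terms by \<open>row_sum_in\<close>, and it makes the two
    double sums range over the same product.\<close>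
  have half: "(\<Sum>i\<in>I. pos_sign i I * P (I - {i}) * row_sum i J) = (\<Sum>i\<in>I - J. pos_sign i (sym_diff I J)
       * P (sym_diff I {i}) * P (sym_diff J {i}))"
    if "I \<subseteq> V" "J \<subseteq> V" "finite I" "finite J" for I J
  proof -
    have "(\<Sum>i\<in>I. pos_sign i I * P (I - {i}) * row_sum i J) = (\<Sum>i\<in>I - J. pos_sign i I * P (I - {i}) * row_sum i J)"
      by (rule sum.mono_neutral_right) (use that assms in \<open>auto simp: row_sum_in\<close>)
    also have "\<dots> = (\<Sum>i\<in>I - J. pos_sign i (sym_diff I J) * P (sym_diff I {i}) * P (sym_diff J {i}))"
    proof (rule sum.cong[OF refl])
      fix i assume i: "i \<in> I - J"
      then have "row_sum i J = pos_sign i J * P (insert i J)" using that by (intro row_sum_notin) auto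
      moreover have "sym_diff I {i} = I - {i}" "sym_diff J {i} = insert i J" using i by auto
      ultimately show "pos_sign i I * P (I - {i}) * row_sum i J
          = pos_sign i (sym_diff I J) * P (sym_diff I {i}) * P (sym_diff J {i})"
        using that by (simp add: pos_sign_sym_diff mult_ac)
    qed
    finally show ?thesis .
  qed
  have "(\<Sum>x\<in>sym_diff I J. T x) = (\<Sum>x\<in>I - J. T x) + (\<Sum>x\<in>J - I. T x)"
    by (rule sum.union_disjoint) (use fin in auto)
  also have "(\<Sum>x\<in>I - J. T x) = (\<Sum>i\<in>I. pos_sign i I * P (I - {i}) * row_sum i J)"
    using half[of I J] assms fin by (simp add: T_def)
  also have "(\<Sum>x\<in>J - I. T x) = (\<Sum>j\<in>J. pos_sign j J * P (J - {j}) * row_sum j I)"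
    using half[of J I] assms fin by (simp add: T_def Un_commute mult_ac)
  also have "(\<Sum>i\<in>I. pos_sign i I * P (I - {i}) * row_sum i J)
      = (\<Sum>i\<in>I. \<Sum>j\<in>J. pos_sign i I * P (I - {i}) * (pos_sign j J * a i j * P (J - {j})))"
    by (simp add: row_sum_def sum_distrib_left)
  also have "\<dots> = (\<Sum>j\<in>J. \<Sum>i\<in>I. pos_sign i I * P (I - {i}) * (pos_sign j J * a i j * P (J - {j})))"
    by (rule sum.swap)
  also have "\<dots> = (\<Sum>j\<in>J. \<Sum>i\<in>I. - (pos_sign j J * P (J - {j}) * (pos_sign i I * a j i * P (I - {i}))))"
  proof (intro sum.cong refl)
    fix i j assume "i \<in> I" "j \<in> J"
    then have "a i j = - a j i" using assms by (intro skew) auto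
    then show "pos_sign i I * P (I - {i}) * (pos_sign j J * a i j * P (J - {j}))
        = - (pos_sign j J * P (J - {j}) * (pos_sign i I * a j i * P (I - {i})))"
      by (simp add: mult_ac)
  qed
  also have "\<dots> = - (\<Sum>j\<in>J. pos_sign j J * P (J - {j}) * row_sum j I)"
    by (simp add: row_sum_def sum_distrib_left sum_negf)
  finally show ?thesis by (simp add: T_def)
qed

end

subsection \<open>Wick equations\<close>

text \<open>The entry at position \<open>j\<close>, counted from 1, has \<open>j - 1\<close>
  predecessors, so the two sums differ only by a global sign. Summing over elements removes the
  enumeration from later arguments.\<close>

lemma wick_equation_iff:
  assumes "finite J1" "finite J2"
  shows "wick_equation X J1 J2 \<longleftrightarrow>
    (\<Sum>x\<in>sym_diff J1 J2. pos_sign x (sym_diff J1 J2) * X (sym_diff J1 {x}) * X (sym_diff J2 {x})) = 0"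
proof -
  define D where "D = sym_diff J1 J2"
  define xs where "xs = sorted_list_of_set D"
  have "finite D" using assms by (simp add: D_def)
  then have xs: "set xs = D" "sorted_wrt (<) xs" "distinct xs" by (auto simp: xs_def)
  have sign: "pos_sign (xs ! i) D = (-1 :: 'a) ^ i" if "i < length xs" for i
  proof -
    have "{k \<in> D. k < xs ! i} = (!) xs ` {..<i}"
    proof (intro equalityI subsetI)
      fix k assume "k \<in> {k \<in> D. k < xs ! i}"
      then obtain j where j: "j < length xs" "k = xs ! j" "xs ! j < xs ! i"
        using xs by (metis (mono_tags, lifting) in_set_conv_nth mem_Collect_eq)
      moreover have "j < i"
        using j that sorted_wrt_nth_less[OF xs(2), of i j] by (metis linorder_neqE_nat not_less_iff_gr_or_eq)
      ultimately show "k \<in> (!) xs ` {..<i}" by auto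
    next
      fix k assume "k \<in> (!) xs ` {..<i}"
      then show "k \<in> {k \<in> D. k < xs ! i}"
        using that sorted_wrt_nth_less[OF xs(2)] xs(1) by (auto simp flip: xs(1))
    qed
    moreover have "inj_on ((!) xs) {..<i}" using xs that by (simp add: inj_on_nth)
    ultimately show ?thesis by (simp add: pos_sign_def card_image)
  qed
  have "(\<Sum>j = 1..length xs. (-1) ^ j * X (sym_diff J1 {xs ! (j - 1)}) * X (sym_diff J2 {xs ! (j - 1)}))
      = (\<Sum>i<length xs. (-1) ^ Suc i * X (sym_diff J1 {xs ! i}) * X (sym_diff J2 {xs ! i}))"
    by (rule sum.reindex_bij_witness[of _ Suc "\<lambda>j. j - 1"]) auto
  also have "\<dots> = - (\<Sum>i<length xs. pos_sign (xs ! i) D * X (sym_diff J1 {xs ! i}) * X (sym_diff J2 {xs ! i}))"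
    by (simp add: sign sum_negf)
  also have "(\<Sum>i<length xs. pos_sign (xs ! i) D * X (sym_diff J1 {xs ! i}) * X (sym_diff J2 {xs ! i}))
      = (\<Sum>x\<in>D. pos_sign x D * X (sym_diff J1 {x}) * X (sym_diff J2 {x}))"
    by (rule sum.reindex_bij_betw[OF bij_betw_nth[OF xs(3) refl xs(1)[symmetric]],
          of "\<lambda>x. pos_sign x D * X (sym_diff J1 {x}) * X (sym_diff J2 {x})"])
  finally show ?thesis
    unfolding wick_equation_def Let_def D_def[symmetric] xs_def[symmetric] by simp
qed

subsection \<open>Pfaffians of principal submatrices\<close>

lemma pick_eqI: "i \<in> J \<Longrightarrow> card {k \<in> J. k < i} = c \<Longrightarrow> pick J c = i"
  by (metis pick_card_in_set)

text \<open>\<open>pick J\<close> is strictly increasing on \<open>{..<card J}\<close>, hence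
  preserves ranks.\<close>

lemma pick_image:
  assumes "finite J" "S \<subseteq> {..<card J}" "i < card S"
  shows "pick (pick J ` S) i = pick J (pick S i)"
proof -
  have mono: "pick J k < pick J l \<longleftrightarrow> k < l" if "k < card J" "l < card J" for k l
    using pick_mono_le[of k J l] pick_mono_le[of l J k] that
    by (metis linorder_neqE_nat not_less_iff_gr_or_eq)
  have s: "pick S i \<in> S" using assms by (intro pick_in_set_le)
  have "{y \<in> pick J ` S. y < pick J (pick S i)} = pick J ` {k \<in> S. k < pick S i}"
    using assms(2) s mono by (auto simp: subset_iff)
  moreover have "inj_on (pick J) {..<card J}"
    by (rule inj_onI) (metis lessThan_iff linorder_neqE_nat mono less_irrefl)
  then have "inj_on (pick J) {k \<in> S. k < pick S i}"
    using assms(2) by (elim inj_on_subset) auto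
  ultimately have "card {y \<in> pick J ` S. y < pick J (pick S i)} = i"
    using assms by (simp add: card_image card_pick_le)
  then show ?thesis using pick_card_in_set[of "pick J (pick S i)" "pick J ` S"] s by simp
qed

lemma bij_betw_pick:
  assumes "finite J"
  shows "bij_betw (pick J) {..<card J} J"
proof -
  have "inj_on (pick J) {..<card J}"
    by (rule inj_onI) (metis lessThan_iff linorder_neqE_nat pick_mono_le less_irrefl)
  moreover have "pick J ` {..<card J} \<subseteq> J" by (auto intro: pick_in_set_le)
  ultimately show ?thesis
    using assms by (metis bij_betw_def card_image card_lessThan card_subset_eq)
qed

lemma dim_principal_submatrix:
  assumes "A \<in> carrier_mat n n" "J \<subseteq> {..<n}"
  shows "dim_row (submatrix A J J) = card J" "dim_col (submatrix A J J) = card J"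
proof -
  have "{i. i < n \<and> i \<in> J} = J" using assms by auto
  then show "dim_row (submatrix A J J) = card J" "dim_col (submatrix A J J) = card J"
    using assms by (auto simp: dim_submatrix)
qed

lemma principal_submatrix_index:
  assumes "A \<in> carrier_mat n n" "J \<subseteq> {..<n}" "i < card J" "j < card J"
  shows "submatrix A J J $$ (i, j) = A $$ (pick J i, pick J j)"
  using assms dim_principal_submatrix[OF assms(1,2)]
  by (intro submatrix_index) (auto simp: dim_submatrix)

text \<open>\<open>S\<close> consists of positions within \<open>J\<close>, which
  \<open>pick J\<close> turns back into indices of \<open>A\<close>. So the recursion for
  \<open>pfaffian\<close>, which renumbers at each level, stays among principal submatrices of
  \<open>A\<close>.\<close>

lemma principal_submatrix_submatrix:
  assumes A: "A \<in> carrier_mat n n" and J: "J \<subseteq> {..<n}" and S: "S \<subseteq> {..<card J}"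
  shows "submatrix (submatrix A J J) S S = submatrix A (pick J ` S) (pick J ` S)"
proof -
  have fin: "finite J" using J finite_subset by auto
  have B: "submatrix A J J \<in> carrier_mat (card J) (card J)"
    using dim_principal_submatrix[OF A J] by auto
  have bij: "bij_betw (pick J) {..<card J} J" by (rule bij_betw_pick[OF fin])
  have sub: "pick J ` S \<subseteq> {..<n}" using bij S J by (auto simp: bij_betw_def)
  have card: "card (pick J ` S) = card S"
    using bij S by (metis bij_betw_def card_image inj_on_subset)
  have less: "pick S i < card J" if "i < card S" for i
    using pick_in_set_le[OF that] S by auto
  show ?thesis
    by (rule eq_matI)
      (use card less in \<open>simp_all add: dim_principal_submatrix[OF A sub] dim_principal_submatrix[OF B S]
        principal_submatrix_index[OF A sub] principal_submatrix_index[OF B S]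
        principal_submatrix_index[OF A J] pick_image[OF fin S]\<close>)
qed

section \<open>Small, odd and first-row cases of the Pfaffian\<close>

lemma pfaffian_odd: "odd (dim_row A) \<Longrightarrow> pfaffian A = 0"
  by (cases "dim_row A = 0") (simp_all add: pfaffian.simps[of A])

lemma pfaffian_empty: "dim_row A = 0 \<Longrightarrow> pfaffian A = 1"
  by (subst pfaffian.simps) (auto simp: Let_def)

lemma pfaffian_2: "dim_row A = 2 \<Longrightarrow> pfaffian A = A $$ (0, 1)"
  by (subst pfaffian.simps) (auto simp: Let_def)

lemma pfaffian_principal_empty: "pfaffian (submatrix A {} {}) = 1"
  by (rule pfaffian_empty) (simp add: dim_submatrix)

lemma pfaffian_principal_pair:
  assumes A: "A \<in> carrier_mat n n" and ij: "i < j" "j < n"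
  shows "pfaffian (submatrix A {i, j} {i, j}) = A $$ (i, j)"
proof -
  have J: "{i, j} \<subseteq> {..<n}" "card {i, j} = 2" using ij by auto
  have below: "{k \<in> {i, j}. k < i} = {}" "{k \<in> {i, j}. k < j} = {i}" using ij by auto
  have "pick {i, j} 0 = i" by (rule pick_eqI) (simp, unfold below, simp)
  moreover have "pick {i, j} 1 = j" by (rule pick_eqI) (simp, unfold below, simp)
  ultimately show ?thesis
    using pfaffian_2[of "submatrix A {i, j} {i, j}"] dim_principal_submatrix[OF A J(1)]
      principal_submatrix_index[OF A J(1), of 0 1] J(2) by simp
qed

lemma pfaffian_principal_odd:
  assumes "A \<in> carrier_mat n n" "J \<subseteq> {..<n}" "odd (card J)"
  shows "pfaffian (submatrix A J J) = 0"
  using assms by (intro pfaffian_odd) (simp add: dim_principal_submatrix)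

text \<open>This rewrites the recursion by positions as one by elements, in the form of
  \<open>expand_Min\<close>. If \<open>K\<close> has even size, only Pfaffians of odd size occur and
  both sides vanish; a singleton \<open>K\<close> is the base case of size 2; otherwise the
  recursion itself applies.\<close>

lemma pfaffian_principal_expand:
  assumes A: "A \<in> carrier_mat n n" and J: "insert m K \<subseteq> {..<n}" and m: "\<forall>k\<in>K. m < k"
  shows "pfaffian (submatrix A (insert m K) (insert m K)) =
    (\<Sum>j\<in>K. pos_sign j K * A $$ (m, j) * pfaffian (submatrix A (K - {j}) (K - {j})))"
proof -
  define J where "J = insert m K"
  have J: "J \<subseteq> {..<n}" using J by (simp add: J_def)
  have fin: "finite K" "finite J" using J finite_subset by (auto simp: J_def)
  have mK: "m \<notin> K" using m by auto
  have cardJ: "card J = Suc (card K)" using fin mK by (simp add: J_def)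
  consider "even (card K)" | "card K = 1" | "odd (card K)" "card K \<noteq> 1" by blast
  then show ?thesis
  proof cases
    case 1
    have "pfaffian (submatrix A (K - {j}) (K - {j})) = 0" if "j \<in> K" for j
    proof (rule pfaffian_principal_odd[OF A])
      have "card K = Suc (card (K - {j}))" using that fin by (metis card.remove)
      then show "odd (card (K - {j}))" using 1 by simp
    qed (use J J_def in auto)
    moreover have "pfaffian (submatrix A J J) = 0"
      using 1 cardJ by (intro pfaffian_principal_odd[OF A J]) simp
    ultimately show ?thesis by (simp add: J_def)
  next
    case 2
    then obtain j where j: "K = {j}" by (metis card_1_singletonE)
    then show ?thesis
      using pfaffian_principal_pair[OF A, of m j] J m
      by (simp add: J_def pos_sign_Min pfaffian_principal_empty)
  next
    case 3
    define B where "B = submatrix A J J"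
    have dim: "dim_row B = card J" using dim_principal_submatrix[OF A J] by (simp add: B_def)
    have bij: "bij_betw (pick J) {..<card J} J" by (rule bij_betw_pick[OF fin(2)])
    have below: "{k \<in> J. k < m} = {}" using m by (auto simp: J_def)
    have pick0: "pick J 0 = m" by (rule pick_eqI) (simp add: J_def, unfold below, simp)
    have "{..<card J} = insert 0 {1..<card J}" using cardJ by auto
    then have "bij_betw (pick J) ({..<card J} - {0}) (J - {pick J 0})"
      using bij by (intro bij_betw_DiffI) (auto simp: bij_betw_def)
    moreover have "{..<card J} - {0} = {1..<card J}" "J - {pick J 0} = K"
      using pick0 mK by (auto simp: J_def)
    ultimately have bijK: "bij_betw (pick J) {1..<card J} K" by simp
    have "pfaffian B = (\<Sum>j\<in>{1..<card J}. (-1) ^ (j + 1) * pfaffian (submatrix B {0, j} {0, j})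
        * pfaffian (submatrix B ({1..<card J} - {j}) ({1..<card J} - {j})))"
      using 3 cardJ by (subst pfaffian.simps) (simp add: Let_def dim)
    also have "\<dots> = (\<Sum>j\<in>{1..<card J}. pos_sign (pick J j) K * A $$ (m, pick J j)
        * pfaffian (submatrix A (K - {pick J j}) (K - {pick J j})))"
    proof (rule sum.cong[OF refl])
      fix j assume j: "j \<in> {1..<card J}"
      have pj: "pick J j \<in> K" using bijK j by (auto simp: bij_betw_def)
      \<comment> \<open>Position \<open>j\<close> in \<open>J\<close> counts \<open>m\<close> too,
        so \<open>pick J j\<close> has \<open>j - 1\<close> predecessors in \<open>K\<close>, which
        has the parity of the exponent \<open>j + 1\<close>.\<close>
      have "{k \<in> J. k < pick J j} = insert m {k \<in> K. k < pick J j}"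
        using m pj by (auto simp: J_def)
      then have j_eq: "Suc (card {k \<in> K. k < pick J j}) = j"
        using card_pick_le[of j J] j fin mK by simp
      have "pos_sign (pick J j) K = (-1 :: 'a) ^ (j + 1)"
        using arg_cong[OF j_eq, of "\<lambda>i. (-1 :: 'a) ^ (i + 1)"] by (simp add: pos_sign_def)
      moreover have "submatrix B {0, j} {0, j} = submatrix A {m, pick J j} {m, pick J j}"
        unfolding B_def using j cardJ
        by (subst principal_submatrix_submatrix[OF A J]) (auto simp: pick0 simp del: pick.simps)
      moreover have "pfaffian (submatrix A {m, pick J j} {m, pick J j}) = A $$ (m, pick J j)"
        using pj m J by (intro pfaffian_principal_pair[OF A]) (auto simp: J_def)
      moreover have "pick J ` ({1..<card J} - {j}) = K - {pick J j}"
        using bijK j by (simp add: bij_betw_def inj_on_image_set_diff[where C = "{1..<card J}"])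
      then have "submatrix B ({1..<card J} - {j}) ({1..<card J} - {j})
          = submatrix A (K - {pick J j}) (K - {pick J j})"
        unfolding B_def by (subst principal_submatrix_submatrix[OF A J]) auto
      ultimately show "(-1) ^ (j + 1) * pfaffian (submatrix B {0, j} {0, j})
          * pfaffian (submatrix B ({1..<card J} - {j}) ({1..<card J} - {j}))
        = pos_sign (pick J j) K * A $$ (m, pick J j)
          * pfaffian (submatrix A (K - {pick J j}) (K - {pick J j}))"
        by simp
    qed
    also have "\<dots> = (\<Sum>j\<in>K. pos_sign j K * A $$ (m, j) * pfaffian (submatrix A (K - {j}) (K - {j})))"
      by (rule sum.reindex_bij_betw[OF bijK])
    finally show ?thesis by (simp add: B_def J_def)
  qed
qed

section \<open>Wick equations for a skew-symmetric matrix\<close>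

lemma skew_symmetric_index:
  assumes "A \<in> carrier_mat n n" "skew_symmetric A" "i < n" "j < n"
  shows "A $$ (j, i) = - A $$ (i, j)"
proof -
  have "transpose_mat A $$ (i, j) = (- A) $$ (i, j)" using assms by (simp add: skew_symmetric_def)
  then show ?thesis using assms by simp
qed

lemma pfaffian_function_principal:
  assumes "A \<in> carrier_mat n n" "skew_symmetric A"
  shows "pfaffian_function {..<n} (\<lambda>i j. A $$ (i, j)) (\<lambda>J. pfaffian (submatrix A J J))"
proof
  fix i j assume "i \<in> {..<n}" "j \<in> {..<n}"
  then show "A $$ (j, i) = - A $$ (i, j)" by (intro skew_symmetric_index[OF assms]) auto
qed (use assms(1) in \<open>auto intro: pfaffian_principal_expand\<close>)

lemma wick_equation_pfaffian:
  assumes "A \<in> carrier_mat n n" "skew_symmetric A" "J1 \<subseteq> {..<n}" "J2 \<subseteq> {..<n}"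
  shows "wick_equation (\<lambda>J. pfaffian (submatrix A J J)) J1 J2"
proof -
  have "finite J1" "finite J2" using assms finite_subset by auto
  moreover have "A $$ (i, i) = 0" if "i < n" for i
    using that assms by (auto simp: skew_symmetric_def)
  ultimately show ?thesis
    using pfaffian_function.wick_relation[OF pfaffian_function_principal[OF assms(1,2)] assms(3,4)]
    by (simp add: wick_equation_iff)
qed

subsection \<open>From weak orthogonal matroids to Pfaffians\<close>

text \<open>The exchange axiom for \<open>J\<close> and the empty basis: their symmetric difference
  is \<open>J\<close>, so an exchange can only delete elements.\<close>

lemma orthogonal_matroid_remove_pair:
  assumes "orthogonal_matroid E \<B>" "{} \<in> \<B>" "J \<in> \<B>" "x \<in> J"
  obtains y where "y \<in> J" "y \<noteq> x" "J - {x, y} \<in> \<B>"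
proof -
  have "\<forall>x1\<in>sym_diff J {}. \<exists>x2\<in>sym_diff J {}. x2 \<noteq> x1 \<and> sym_diff J {x1, x2} \<in> \<B>"
    using assms(1-3) unfolding orthogonal_matroid_def by blast
  then obtain y where y: "y \<in> J" "y \<noteq> x" "sym_diff J {x, y} \<in> \<B>" using assms(4) by auto
  moreover have "sym_diff J {x, y} = J - {x, y}" using y assms(4) by auto
  ultimately show ?thesis using that by simp
qed

text \<open>Deleting pairs repeatedly leads from any finite basis down to the empty one.\<close>

lemma orthogonal_matroid_even_card:
  assumes "orthogonal_matroid E \<B>" "{} \<in> \<B>" "finite J" "J \<in> \<B>"
  shows "even (card J)"
  using assms(3,4)
proof (induction J rule: finite_psubset_induct)
  case (psubset J)
  show ?case
  proof (cases "J = {}")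
    case False
    then obtain x where x: "x \<in> J" by auto
    obtain y where y: "y \<in> J" "y \<noteq> x" "J - {x, y} \<in> \<B>"
      by (rule orthogonal_matroid_remove_pair[OF assms(1,2) psubset.prems x])
    have "J - {x, y} \<subset> J" using x by auto
    then have "even (card (J - {x, y}))" using y by (intro psubset.IH)
    moreover have "card J = card (J - {x, y}) + card {x, y}"
      using x y psubset.hyps by (metis card_Diff_subset card_mono empty_subsetI finite.emptyI
          finite_insert insert_subset le_add_diff_inverse2)
    ultimately show ?thesis using y by simp
  qed simp
qed

text \<open>In the equation used, the term of \<open>a\<close> is
  \<open>X T * X (T \<union> D)\<close> up to sign, and the other terms involve only proper subsets
  of \<open>T \<union> D\<close>, where \<open>X\<close> and \<open>Y\<close> agree. The unit
  \<open>X T\<close> can be cancelled.\<close>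

lemma four_term_wick_determines:
  assumes "partial_field G" "finite T" "card D = 4" "T \<inter> D = {}" "a \<in> D"
    and X: "wick_equation X (insert a T) (T \<union> (D - {a}))"
    and Y: "wick_equation Y (insert a T) (T \<union> (D - {a}))"
    and eq: "\<And>I. I \<subset> T \<union> D \<Longrightarrow> X I = Y I" and "X T \<in> G"
  shows "X (T \<union> D) = Y (T \<union> D)"
proof -
  have fin: "finite D" using assms(3) by (metis card.infinite zero_neq_numeral)
  have sd: "sym_diff (insert a T) (T \<union> (D - {a})) = D" using assms(4,5) by auto
  define R where "R Z = (\<Sum>x\<in>D - {a}. pos_sign x D * Z (insert x (insert a T)) * Z (T \<union> (D - {a, x})))"
    for Z :: "nat set \<Rightarrow> 'a"
  have wick: "pos_sign a D * Z T * Z (T \<union> D) + R Z = 0"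
    if "wick_equation Z (insert a T) (T \<union> (D - {a}))" for Z :: "nat set \<Rightarrow> 'a"
  proof -
    have "(\<Sum>x\<in>D. pos_sign x D * Z (sym_diff (insert a T) {x}) * Z (sym_diff (T \<union> (D - {a})) {x})) = 0"
      using wick_equation_iff[of "insert a T" "T \<union> (D - {a})" Z] that assms(2) fin sd by simp
    also have "(\<Sum>x\<in>D. pos_sign x D * Z (sym_diff (insert a T) {x}) * Z (sym_diff (T \<union> (D - {a})) {x}))
        = pos_sign a D * Z (sym_diff (insert a T) {a}) * Z (sym_diff (T \<union> (D - {a})) {a})
          + (\<Sum>x\<in>D - {a}. pos_sign x D * Z (sym_diff (insert a T) {x}) * Z (sym_diff (T \<union> (D - {a})) {x}))"
      by (rule sum.remove[OF fin assms(5)])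
    also have "sym_diff (insert a T) {a} = T" using assms(4,5) by auto
    also have "sym_diff (T \<union> (D - {a})) {a} = T \<union> D" using assms(4,5) by auto
    also have "(\<Sum>x\<in>D - {a}. pos_sign x D * Z (sym_diff (insert a T) {x}) * Z (sym_diff (T \<union> (D - {a})) {x})) = R Z"
      unfolding R_def
    proof (rule sum.cong[OF refl])
      fix x assume "x \<in> D - {a}"
      then have "sym_diff (insert a T) {x} = insert x (insert a T)"
        "sym_diff (T \<union> (D - {a})) {x} = T \<union> (D - {a, x})" using assms(4) by auto
      then show "pos_sign x D * Z (sym_diff (insert a T) {x}) * Z (sym_diff (T \<union> (D - {a})) {x})
          = pos_sign x D * Z (insert x (insert a T)) * Z (T \<union> (D - {a, x}))" by simp
    qed
    finally show ?thesis by simp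
  qed
  have "R X = R Y" unfolding R_def
  proof (rule sum.cong[OF refl])
    fix x assume x: "x \<in> D - {a}"
    \<comment> \<open>Because \<open>D\<close> has four elements, adding only \<open>a\<close> and
      \<open>x\<close> to \<open>T\<close> gives a proper subset.\<close>
    have "{a, x} \<noteq> D" using assms(3) by (auto simp: card_insert_if split: if_splits)
    then have "insert x (insert a T) \<subset> T \<union> D" "T \<union> (D - {a, x}) \<subset> T \<union> D"
      using x assms(4,5) by blast+
    then show "pos_sign x D * X (insert x (insert a T)) * X (T \<union> (D - {a, x}))
        = pos_sign x D * Y (insert x (insert a T)) * Y (T \<union> (D - {a, x}))" by (simp add: eq)
  qed
  moreover have "X T = Y T" using assms(4,5) by (intro eq) auto
  ultimately have "pos_sign a D * (X T * X (T \<union> D)) = pos_sign a D * (X T * Y (T \<union> D))"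
    using wick[OF X] wick[OF Y] by (metis add_right_cancel mult.assoc)
  then have "X T * X (T \<union> D) = X T * Y (T \<union> D)" by (metis pos_sign_square_left)
  then have "X T * (X (T \<union> D) - Y (T \<union> D)) = 0" by (simp add: right_diff_distrib)
  then show ?thesis using partial_field_mult_eq_0[OF assms(1) \<open>X T \<in> G\<close>] by simp
qed

text \<open>
  By induction on \<open>J\<close>. If some basis \<open>T\<close> arises from \<open>J\<close> by deleting four elements, then the
  4-term Wick equation containing $p_T p_J$ determines \<open>p J\<close>, as $p_T$ is a unit. Otherwise
  exchanging with the empty basis shows that neither \<open>J\<close> nor any \<open>J\<close> minus two elements is a
  basis, so both sides vanish.
\<close>

lemma weak_eq_pfaffian:
  fixes p :: "nat set \<Rightarrow> 'a::comm_ring_1"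
  assumes G: "partial_field G" and p: "\<And>J. J \<subseteq> {..<n} \<Longrightarrow> p J \<in> insert 0 G" and p0: "p {} = 1"
    and wick: "\<And>J1 J2. J1 \<subseteq> {..<n} \<Longrightarrow> J2 \<subseteq> {..<n} \<Longrightarrow> card (sym_diff J1 J2) = 4 \<Longrightarrow> wick_equation p J1 J2"
    and om: "orthogonal_matroid {..<n} (vector_support n p)"
    and A: "A \<in> carrier_mat n n" "skew_symmetric A"
    and pair: "\<And>i j. i < j \<Longrightarrow> j < n \<Longrightarrow> A $$ (i, j) = p {i, j}"
    and "J \<subseteq> {..<n}"
  shows "p J = pfaffian (submatrix A J J)"
proof -
  have basis: "J \<in> vector_support n p \<longleftrightarrow> p J \<noteq> 0" if "J \<subseteq> {..<n}" for J
    using that by (simp add: vector_support_def)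
  have empty: "{} \<in> vector_support n p" using p0 by (simp add: basis)
  have "finite J" using \<open>J \<subseteq> {..<n}\<close> finite_subset by auto
  then show ?thesis using \<open>J \<subseteq> {..<n}\<close>
  proof (induction J rule: finite_psubset_induct)
    case (psubset J)
    have IH: "p I = pfaffian (submatrix A I I)" if "I \<subset> J" for I
      using that psubset by auto
    consider "odd (card J)" | "J = {}" | "card J = 2" | "even (card J)" "card J \<ge> 4"
    proof -
      have "card J = 0 \<or> card J = 1 \<or> card J = 2 \<or> card J = 3 \<or> card J \<ge> 4" by linarith
      then show ?thesis using that psubset.hyps by auto
    qed
    then show ?case
    proof cases
      case 1
      then have "p J = 0"
        using orthogonal_matroid_even_card[OF om empty psubset.hyps] psubset.prems basis by auto
      then show ?thesis using pfaffian_principal_odd[OF A(1) psubset.prems 1] by simp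
    next
      case 2
      then show ?thesis by (simp add: p0 pfaffian_principal_empty)
    next
      case 3
      then obtain x y where "J = {x, y}" "x \<noteq> y" by (auto simp: card_2_iff)
      then obtain i j where ij: "J = {i, j}" "i < j" by (metis insert_commute linorder_neqE_nat)
      then show ?thesis using pair[of i j] pfaffian_principal_pair[OF A(1), of i j] psubset.prems by simp
    next
      case 4
      show ?thesis
      proof (cases "\<exists>T D. J = T \<union> D \<and> T \<inter> D = {} \<and> card D = 4 \<and> p T \<noteq> 0")
        case True
        then obtain T D where TD: "J = T \<union> D" "T \<inter> D = {}" "card D = 4" "p T \<noteq> 0" by blast
        then have "D \<noteq> {}" by auto
        then obtain a where a: "a \<in> D" by auto
        have sub: "insert a T \<subseteq> {..<n}" "T \<union> (D - {a}) \<subseteq> {..<n}" using TD psubset.prems a by auto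
        have "sym_diff (insert a T) (T \<union> (D - {a})) = D" using TD a by auto
        then have "wick_equation p (insert a T) (T \<union> (D - {a}))" using sub TD by (intro wick) auto
        moreover have "p T \<in> G" using p[of T] TD psubset.prems by auto
        moreover have "finite T" using TD psubset.hyps by auto
        moreover have "p I = pfaffian (submatrix A I I)" if "I \<subset> T \<union> D" for I
          using that IH TD(1) by simp
        ultimately have "p (T \<union> D) = pfaffian (submatrix A (T \<union> D) (T \<union> D))"
          using four_term_wick_determines[OF G _ TD(3,2) a _ wick_equation_pfaffian[OF A sub]] by blast
        then show ?thesis by (simp only: TD(1))
      next
        case False
        \<comment> \<open>Such a basis \<open>K\<close> is nonempty and would lose another pair to
          become a basis obtained from \<open>J\<close> by deleting four elements, against
          \<open>False\<close>.\<close>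
        have no_basis: "p K = 0" if K: "K \<subseteq> J" "card K + 2 = card J" for K
        proof (rule ccontr)
          assume "p K \<noteq> 0"
          then have "K \<in> vector_support n p" using K psubset.prems by (simp add: basis)
          moreover have "K \<noteq> {}" using K 4 by auto
          then obtain x where x: "x \<in> K" by auto
          ultimately obtain y where y: "y \<in> K" "y \<noteq> x" "K - {x, y} \<in> vector_support n p"
            using orthogonal_matroid_remove_pair[OF om empty] by metis
          have "finite K" using K psubset.hyps finite_subset by auto
          have "card (K - {x, y}) = card K - card {x, y}"
            using x y by (intro card_Diff_subset) auto
          moreover have "card {x, y} \<le> card K" using x y \<open>finite K\<close> by (intro card_mono) auto
          ultimately have "card (K - {x, y}) + 4 = card J" using K y by simp
          then have "card (J - (K - {x, y})) = 4"
            using K psubset.hyps \<open>finite K\<close> by (subst card_Diff_subset) auto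
          moreover have "J = (K - {x, y}) \<union> (J - (K - {x, y}))" using K by auto
          moreover have "p (K - {x, y}) \<noteq> 0" using y by (simp add: vector_support_def)
          ultimately show False using False by (metis Diff_disjoint)
        qed
        have card2: "card (J - {x, y}) + 2 = card J" if "x \<in> J" "y \<in> J" "x \<noteq> y" for x y
        proof -
          have "card (J - {x, y}) = card J - card {x, y}"
            using that psubset.hyps by (intro card_Diff_subset) auto
          then show ?thesis using that 4 by simp
        qed
        have "J \<noteq> {}" using 4 by auto
        \<comment> \<open>The expansion along the minimum \<open>m\<close> has the cofactors of
          \<open>J - {m, j}\<close>, which vanish by \<open>no_basis\<close> and the induction
          hypothesis.\<close>
        define m K where "m = Min J" and "K = J - {m}"
        have "m \<in> J" "\<forall>k\<in>K. m < k"
          using \<open>J \<noteq> {}\<close> psubset.hyps by (auto simp: m_def K_def less_le)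
        then have m: "J = insert m K" "\<forall>k\<in>K. m < k" by (auto simp: K_def)
        have "p J = 0"
        proof (rule ccontr)
          assume "p J \<noteq> 0"
          then have "J \<in> vector_support n p" using psubset.prems by (simp add: basis)
          then obtain y where y: "y \<in> J" "y \<noteq> m" "J - {m, y} \<in> vector_support n p"
            using orthogonal_matroid_remove_pair[OF om empty, of J m] m by blast
          moreover have "p (J - {m, y}) = 0"
            using y m by (intro no_basis card2) auto
          ultimately show False by (simp add: vector_support_def)
        qed
        moreover have "pfaffian (submatrix A (K - {j}) (K - {j})) = 0" if "j \<in> K" for j
        proof -
          have "K - {j} = J - {m, j}" by (auto simp: K_def)
          moreover have "p (J - {m, j}) = 0"
            using that m by (intro no_basis card2) auto
          moreover have "p (K - {j}) = pfaffian (submatrix A (K - {j}) (K - {j}))"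
            using that m by (intro IH) auto
          ultimately show ?thesis by simp
        qed
        then have "pfaffian (submatrix A J J) = 0"
          using pfaffian_principal_expand[OF A(1), of m K] m psubset.prems by simp
        ultimately show ?thesis by simp
      qed
    qed
  qed
qed

section \<open>From strong to weak orthogonal matroids\<close>

text \<open>
  The term of the Wick equation indexed by the exchanged element is $\pm p_{B_1} p_{B_2} \neq 0$, so
  a second term does not vanish.
\<close>

lemma orthogonal_matroid_vector_support:
  assumes G: "partial_field G" and p: "\<And>J. J \<subseteq> {..<n} \<Longrightarrow> p J \<in> insert 0 G"
    and "J0 \<subseteq> {..<n}" "p J0 \<noteq> 0"
    and wick: "\<And>J1 J2. J1 \<subseteq> {..<n} \<Longrightarrow> J2 \<subseteq> {..<n} \<Longrightarrow> wick_equation p J1 J2"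
  shows "orthogonal_matroid {..<n} (vector_support n p)"
  unfolding orthogonal_matroid_def
proof (intro conjI ballI)
  show "vector_support n p \<subseteq> Pow {..<n}" by (auto simp: vector_support_def)
  show "vector_support n p \<noteq> {}" using assms by (auto simp: vector_support_def)
  fix B1 B2 x assume B1: "B1 \<in> vector_support n p" and B2: "B2 \<in> vector_support n p"
    and x: "x \<in> sym_diff B1 B2"
  have sub: "B1 \<subseteq> {..<n}" "B2 \<subseteq> {..<n}" "p B1 \<noteq> 0" "p B2 \<noteq> 0"
    using B1 B2 by (auto simp: vector_support_def)
  \<comment> \<open>Toggling \<open>x\<close> in both sets keeps the symmetric difference, and the
    Wick term of \<open>x\<close> toggles it back to \<open>B1\<close> and
    \<open>B2\<close>.\<close>
  define J1 J2 where "J1 = sym_diff B1 {x}" and "J2 = sym_diff B2 {x}"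
  have J: "J1 \<subseteq> {..<n}" "J2 \<subseteq> {..<n}" using sub x by (auto simp: J1_def J2_def)
  have fin: "finite J1" "finite J2" using J finite_subset by auto
  have D: "sym_diff J1 J2 = sym_diff B1 B2" by (auto simp: J1_def J2_def)
  have finD: "finite (sym_diff B1 B2)" using fin D by (metis finite_Diff finite_Un)
  define T where "T y = pos_sign y (sym_diff B1 B2) * p (sym_diff J1 {y}) * p (sym_diff J2 {y})" for y
  have "(\<Sum>y\<in>sym_diff B1 B2. T y) = 0"
    using wick[OF J] wick_equation_iff[OF fin, of p] by (simp add: D T_def)
  then have "T x + (\<Sum>y\<in>sym_diff B1 B2 - {x}. T y) = 0" using sum.remove[OF finD x, of T] by simp
  moreover have "T x \<noteq> 0"
  proof
    assume "T x = 0"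
    moreover have "sym_diff J1 {x} = B1" "sym_diff J2 {x} = B2" by (auto simp: J1_def J2_def)
    ultimately have "pos_sign x (sym_diff B1 B2) * (p B1 * p B2) = 0" by (simp add: T_def mult.assoc)
    then have "p B1 * p B2 = 0" by (metis mult_zero_right pos_sign_square_left)
    \<comment> \<open>The ring may have zero divisors; the product is nonzero because
      \<open>p B1\<close> is a unit.\<close>
    moreover have "p B1 \<in> G" using p[of B1] sub by auto
    ultimately show False using partial_field_mult_eq_0[OF G] sub by auto
  qed
  ultimately have "(\<Sum>y\<in>sym_diff B1 B2 - {x}. T y) \<noteq> 0" by auto
  then obtain y where y: "y \<in> sym_diff B1 B2 - {x}" "T y \<noteq> 0" by (metis sum.neutral)
  have "p (sym_diff J1 {y}) \<noteq> 0" using y(2) by (auto simp: T_def)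
  moreover have "sym_diff J1 {y} = sym_diff B1 {x, y}" using y by (auto simp: J1_def)
  moreover have "sym_diff B1 {x, y} \<subseteq> {..<n}" using sub x y by auto
  ultimately have "sym_diff B1 {x, y} \<in> vector_support n p" by (simp add: vector_support_def)
  then show "\<exists>x2\<in>sym_diff B1 B2. x2 \<noteq> x \<and> sym_diff B1 {x, x2} \<in> vector_support n p"
    using y(1) by blast
qed

section \<open>Independence of the representative\<close>

lemma scaling_rel_representatives:
  assumes "partial_field G" "c \<in> projective_space G n" "p \<in> c" "q \<in> c"
  shows "(p, q) \<in> scaling_rel G n"
  using assms quotient_eq_iff[OF equiv_scaling_rel[OF assms(1), of n], of c c p q]
  by (simp add: projective_space_def)

text \<open>Representatives differ by a unit and Wick equations are homogeneous, so the normalized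
  vector can stand for its whole class.\<close>

lemma strong_orthogonal_matroid_iff:
  assumes "partial_field G" "c \<in> projective_space G n" "p \<in> c"
  shows "strong_orthogonal_matroid G n c \<longleftrightarrow>
    (\<forall>J1 J2. J1 \<subseteq> {..<n} \<longrightarrow> J2 \<subseteq> {..<n} \<longrightarrow> wick_equation p J1 J2)"
proof -
  have "wick_equation q J1 J2"
    if "q \<in> c" "J1 \<subseteq> {..<n}" "J2 \<subseteq> {..<n}" "wick_equation p J1 J2" for q J1 J2
    using that(4) wick_equation_cong[OF assms(1) scaling_rel_representatives[OF assms that(1)] that(2,3)]
    by blast
  then show ?thesis unfolding strong_orthogonal_matroid_def using assms(2,3) by blast
qed

lemma weak_orthogonal_matroid_iff:
  assumes "partial_field G" "c \<in> projective_space G n" "p \<in> c"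
  shows "weak_orthogonal_matroid G n c \<longleftrightarrow>
    (\<forall>J1 J2. J1 \<subseteq> {..<n} \<longrightarrow> J2 \<subseteq> {..<n} \<longrightarrow> card (sym_diff J1 J2) = 4 \<longrightarrow> wick_equation p J1 J2) \<and>
    orthogonal_matroid {..<n} (vector_support n p)" (is "_ \<longleftrightarrow> ?wick p \<and> ?matroid p")
proof -
  have "?wick q \<and> ?matroid q" if "q \<in> c" "?wick p \<and> ?matroid p" for q
  proof -
    note rel = scaling_rel_representatives[OF assms that(1)]
    have "?wick q" using that(2) wick_equation_cong[OF assms(1) rel] by blast
    then show ?thesis using that(2) by (simp only: vector_support_cong[OF assms(1) rel])
  qed
  then show ?thesis unfolding weak_orthogonal_matroid_def using assms(2,3) by blast
qed

theorem theorem4p2: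
  fixes G :: "'a::comm_ring_1 set" and n :: nat
    and c :: "(nat set \<Rightarrow> 'a) set" and p :: "nat set \<Rightarrow> 'a"
  assumes "partial_field G"
    and "c \<in> projective_space G n" and "p \<in> c" and "p {} = 1"
  shows "((\<exists>A \<in> carrier_mat n n. skew_symmetric A \<and> elements_mat A \<subseteq> insert 0 G \<and>
              (\<forall>J \<subseteq> {..<n}. p J = pfaffian (submatrix A J J)))
            \<longleftrightarrow> strong_orthogonal_matroid G n c) \<and>
         (strong_orthogonal_matroid G n c \<longleftrightarrow> weak_orthogonal_matroid G n c)"
    (is "(?matrix \<longleftrightarrow> ?strong) \<and> (_ \<longleftrightarrow> ?weak)")
proof -
  note strong_iff = strong_orthogonal_matroid_iff[OF assms(1-3)]
  note weak_iff = weak_orthogonal_matroid_iff[OF assms(1-3)]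
  \<comment> \<open>Reflexivity at \<open>p\<close> serves to extract that \<open>p\<close> is a
    vector with entries in \<open>insert 0 G\<close>.\<close>
  have "(p, p) \<in> scaling_rel G n" by (rule scaling_rel_representatives[OF assms(1-3,3)])
  then have p: "p J \<in> insert 0 G" if "J \<subseteq> {..<n}" for J
    using that by (auto simp: scaling_rel_def nonzero_vectors_def PiE_iff)
  \<comment> \<open>The implications are proved as a cycle: matrix, strong, weak, matrix.\<close>
  have "?strong" if ?matrix
    unfolding strong_iff
  proof (intro allI impI)
    fix J1 J2 assume J: "J1 \<subseteq> {..<n}" "J2 \<subseteq> {..<n}"
    obtain A where A: "A \<in> carrier_mat n n" "skew_symmetric A"
      "\<forall>J \<subseteq> {..<n}. p J = pfaffian (submatrix A J J)" using \<open>?matrix\<close> by blast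
    have fin: "finite J1" "finite J2" using J finite_subset by auto
    \<comment> \<open>\<open>p\<close> agrees with the Pfaffians only on subsets of
      \<open>{..<n}\<close>, so the Wick sums are compared term by term.\<close>
    have "p (sym_diff J {x}) = pfaffian (submatrix A (sym_diff J {x}) (sym_diff J {x}))"
      if "J \<subseteq> {..<n}" "x \<in> sym_diff J1 J2" for J x
    proof -
      have "sym_diff J {x} \<subseteq> {..<n}" using that J by auto
      then show ?thesis using A(3) by blast
    qed
    then have "(\<Sum>x\<in>sym_diff J1 J2. pos_sign x (sym_diff J1 J2) * p (sym_diff J1 {x}) * p (sym_diff J2 {x}))
      = (\<Sum>x\<in>sym_diff J1 J2. pos_sign x (sym_diff J1 J2)
          * pfaffian (submatrix A (sym_diff J1 {x}) (sym_diff J1 {x}))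
          * pfaffian (submatrix A (sym_diff J2 {x}) (sym_diff J2 {x})))"
      using J by (intro sum.cong refl) metis
    then show "wick_equation p J1 J2"
      using wick_equation_pfaffian[OF A(1,2) J] by (simp only: wick_equation_iff[OF fin])
  qed
  moreover have "?weak" if ?strong
  proof -
    have wick: "wick_equation p J1 J2" if "J1 \<subseteq> {..<n}" "J2 \<subseteq> {..<n}" for J1 J2
      using \<open>?strong\<close> that by (simp add: strong_iff)
    have "orthogonal_matroid {..<n} (vector_support n p)"
    proof (rule orthogonal_matroid_vector_support[OF assms(1) p])
      show "{} \<subseteq> {..<n}" "p {} \<noteq> 0" by (simp_all add: assms(4))
    qed (simp_all add: wick)
    then show ?thesis using wick by (simp add: weak_iff)
  qed
  moreover have ?matrix if ?weak
  proof -
    \<comment> \<open>The entries above the diagonal are forced, being the Pfaffians of the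
      principal submatrices of size 2; skew-symmetry fixes the rest.\<close>
    define A where "A = mat n n (\<lambda>(i, j). if i < j then p {i, j} else if j < i then - p {i, j} else 0)"
    have A: "A \<in> carrier_mat n n" by (simp add: A_def)
    have "skew_symmetric A"
      by (auto simp: skew_symmetric_def A_def insert_commute intro!: eq_matI)
    moreover have "elements_mat A \<subseteq> insert 0 G"
    proof
      fix x assume "x \<in> elements_mat A"
      then obtain i j where ij: "i < n" "j < n" "x = A $$ (i, j)" using A by auto
      have "- g \<in> insert 0 G" if "g \<in> insert 0 G" for g
      proof (cases "g = 0")
        case False
        then have "-1 * g \<in> G" using that assms(1) unfolding partial_field_def by blast
        then show ?thesis by simp
      qed simp
      then show "x \<in> insert 0 G" using ij p[of "{i, j}"] by (auto simp: A_def)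
    qed
    moreover have "\<forall>J \<subseteq> {..<n}. p J = pfaffian (submatrix A J J)"
    proof (intro allI impI)
      fix J assume "J \<subseteq> {..<n}"
      show "p J = pfaffian (submatrix A J J)"
        by (rule weak_eq_pfaffian[of G n p A J])
          (use \<open>?weak\<close> assms p A \<open>skew_symmetric A\<close> \<open>J \<subseteq> {..<n}\<close> in \<open>simp_all add: weak_iff, simp_all add: A_def\<close>)
    qed
    ultimately show ?thesis using A by blast
  qed
  ultimately show ?thesis by blast
qed

end
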